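(* Let $k\ge 1$ and $\ell\geq 2k-1$ be integers. Let $K_\ell^k$ be a split graph obtained from the complete graph $K_\ell$, whose vertices are drawn on a circle, by adding $\ell$ pairwise non-adjacent vertices such that each added vertex is adjacent to exactly $k$ vertices of $K_\ell$, which are consecutive on the circle, and the neighbourhoods of all the added vertices are distinct. Then $K_\ell^k$ is word-representable.
   Context: Two distinct letters $x,y$ alternate in a word $w$ if deleting all letters of $w$ other than the copies of $x$ and $y$ leaves a word $xyxy\cdots$ or $yxyx\cdots$ (of even or odd length). A graph $G=(V,E)$ (finite, simple) is word-representable if there is a word $w$ over the alphabet $V$, containing each letter of $V$, such that for all distinct $x,y\in V$, $x$ and $y$ alternate in $w$ if and only if $xy\in E$. A split graph is a graph whose vertices can be partitioned into a clique and an independent set. "Consecutive on the circle" means consecutive in the cyclic order of the $\ell$ vertices of $K_\ell$. *)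

theory Defs
  imports Main
begin

definition simple_graph :: "'a set \<Rightarrow> 'a set set \<Rightarrow> bool" where
  "simple_graph V E \<longleftrightarrow> finite V \<and> E \<subseteq> {e. e \<subseteq> V \<and> card e = 2}"

definition neighbourhood :: "'a set set \<Rightarrow> 'a \<Rightarrow> 'a set" where
  "neighbourhood E x = {y. {x, y} \<in> E}"

definition clique :: "'a set set \<Rightarrow> 'a set \<Rightarrow> bool" where
  "clique E K \<longleftrightarrow> (\<forall>x\<in>K. \<forall>y\<in>K. x \<noteq> y \<longrightarrow> {x, y} \<in> E)"

definition independent :: "'a set set \<Rightarrow> 'a set \<Rightarrow> bool" where
  "independent E A \<longleftrightarrow> (\<forall>x\<in>A. \<forall>y\<in>A. {x, y} \<notin> E)"

definition split_partition :: "'a set \<Rightarrow> 'a set set \<Rightarrow> 'a set \<Rightarrow> 'a set \<Rightarrow> bool" where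
  "split_partition V E K A \<longleftrightarrow>
     K \<union> A = V \<and> K \<inter> A = {} \<and> clique E K \<and> independent E A"

definition split_graph :: "'a set \<Rightarrow> 'a set set \<Rightarrow> bool" where
  "split_graph V E \<longleftrightarrow> simple_graph V E \<and> (\<exists>K A. split_partition V E K A)"

text \<open>\<open>alt_word n x y\<close> is the word \<open>xyxy\<dots>\<close> of length \<open>n\<close>.\<close>

primrec alt_word :: "nat \<Rightarrow> 'a \<Rightarrow> 'a \<Rightarrow> 'a list" where
  "alt_word 0 x y = []"
| "alt_word (Suc n) x y = x # alt_word n y x"

definition alternate :: "'a \<Rightarrow> 'a \<Rightarrow> 'a list \<Rightarrow> bool" where
  "alternate x y w \<longleftrightarrow>
     (\<exists>n. filter (\<lambda>z. z = x \<or> z = y) w \<in> {alt_word n x y, alt_word n y x})"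

definition word_representable :: "'a set \<Rightarrow> 'a set set \<Rightarrow> bool" where
  "word_representable V E \<longleftrightarrow>
     (\<exists>w. set w = V \<and>
        (\<forall>x\<in>V. \<forall>y\<in>V. x \<noteq> y \<longrightarrow> (alternate x y w \<longleftrightarrow> {x, y} \<in> E)))"

text \<open>The points \<open>c 0, \<dots>, c (l - 1)\<close> are placed on a circle in this cyclic order; a set is
  consecutive if it is an arc of \<open>m \<le> l\<close> points starting at some \<open>c i\<close>.\<close>

definition consecutive_on_circle :: "nat \<Rightarrow> (nat \<Rightarrow> 'a) \<Rightarrow> 'a set \<Rightarrow> bool" where
  "consecutive_on_circle l c S \<longleftrightarrow>
     (\<exists>i<l. \<exists>m\<le>l. S = (\<lambda>j. c ((i + j) mod l)) ` {..<m})"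

text \<open>\<open>is_K_graph l k V E\<close>: the graph is a \<open>K\<^sub>l\<^sup>k\<close>, with clique \<open>K\<close>, set of added vertices \<open>A\<close>
  and \<open>c\<close> the drawing of \<open>K\<close> on the circle.\<close>

definition is_K_graph :: "nat \<Rightarrow> nat \<Rightarrow> 'a set \<Rightarrow> 'a set set \<Rightarrow> bool" where
  "is_K_graph l k V E \<longleftrightarrow>
     simple_graph V E \<and>
     (\<exists>K A c. split_partition V E K A \<and>
        bij_betw c {..<l} K \<and>
        card A = l \<and>
        (\<forall>a\<in>A. card (neighbourhood E a) = k \<and> consecutive_on_circle l c (neighbourhood E a)) \<and>
        inj_on (neighbourhood E) A)"

lemma is_K_graph_imp_split_graph: "is_K_graph l k V E \<Longrightarrow> split_graph V E"
  by (auto simp: is_K_graph_def split_graph_def)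

end

theory Submission
  imports Defs
begin

text \<open>
  Cut the circle open at \<open>c 0\<close>: an arc either does not pass the cut (added vertices \<open>X\<close>) or does
  (added vertices \<open>Y\<close>). Start from four copies of \<open>c 0 \<dots> c (l - 1)\<close> and insert the added vertices.
  In the first copy \<open>x \<in> X\<close> stands right after its arc and \<open>y \<in> Y\<close> right before the final part of
  its arc; in the last copy \<open>x\<close> stands right before its arc and \<open>y\<close> right after the initial part
  of its arc. In the two middle copies all of \<open>Y\<close> stands at one point that lies in the gap of every
  wrapping arc, in opposite orders, and all of \<open>X\<close> is written
  before the first, between the middle, and (reversed) after the last copy.
  The bound \<open>l \<ge> 2 * k - 1\<close> provides that common point and ensures that no non-wrapping arc
  covers the gap of a wrapping one, which is what keeps \<open>x\<close> and \<open>y\<close> from alternating.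
\<close>

lemma distinct_adj_alt_word: "x \<noteq> y \<Longrightarrow> distinct_adj (alt_word n x y)"
proof (induction n arbitrary: x y)
  case (Suc n)
  then show ?case by (cases n) (auto simp: distinct_adj_Cons)
qed simp

lemma distinct_adj_imp_alt_word:
  assumes "distinct_adj (x # u)" "set u \<subseteq> {x, y}"
  shows "x # u = alt_word (Suc (length u)) x y"
  using assms
proof (induction u arbitrary: x y)
  case (Cons z u)
  then have "z = y" by (auto simp: distinct_adj_Cons)
  with Cons.prems have "set u \<subseteq> {y, x}" by auto
  with Cons.IH[of y x] Cons.prems \<open>z = y\<close> show ?case
    by (auto simp: distinct_adj_Cons)
qed simp

text \<open>Trades the unknown length in \<open>alternate\<close> for a condition that
  simplification evaluates on short lists.\<close>

lemma alternate_iff_distinct_adj: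
  assumes "x \<noteq> y"
  shows "alternate x y w \<longleftrightarrow> distinct_adj (filter (\<lambda>z. z = x \<or> z = y) w)"
    (is "_ \<longleftrightarrow> distinct_adj ?u")
proof
  assume "alternate x y w"
  then show "distinct_adj ?u"
    using assms distinct_adj_alt_word[of x y] distinct_adj_alt_word[of y x]
    unfolding alternate_def by auto
next
  assume adj: "distinct_adj ?u"
  have sub: "set ?u \<subseteq> {x, y}" by auto
  show "alternate x y w"
  proof (cases ?u)
    case Nil
    then have "?u = alt_word 0 x y" by simp
    then show ?thesis unfolding alternate_def by blast
  next
    case (Cons z v)
    then have "z = x \<or> z = y" "set v \<subseteq> {x, y}" using sub by auto
    then have "z # v = alt_word (Suc (length v)) x y \<or> z # v = alt_word (Suc (length v)) y x"
      using adj Cons distinct_adj_imp_alt_word[of z v x] distinct_adj_imp_alt_word[of z v y]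
      by (auto simp: insert_commute)
    then show ?thesis using Cons unfolding alternate_def by (metis insert_iff)
  qed
qed

lemma alternate_commute: "alternate x y w \<longleftrightarrow> alternate y x w"
  by (auto simp: alternate_def disj_commute)

lemma filter_pair_distinct:
  assumes "distinct vs" "x \<in> set vs" "y \<in> set vs" "x \<noteq> y"
  shows "filter (\<lambda>z. z = x \<or> z = y) vs \<in> {[x, y], [y, x]}"
proof -
  have single: "filter (\<lambda>z. z = v) ws = (if v \<in> set ws then [v] else [])"
    if "distinct ws" for v :: 'a and ws
    using that by (induction ws) auto
  show ?thesis using assms
  proof (induction vs)
    case (Cons v vs)
    consider "v = x" | "v = y" | "v \<noteq> x" "v \<noteq> y" by blast
    then show ?case
    proof cases
      case 1
      then have "filter (\<lambda>z. z = x \<or> z = y) vs = filter (\<lambda>z. z = y) vs"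
        using Cons.prems by (intro filter_cong) auto
      then show ?thesis using 1 Cons.prems by (auto simp: single)
    next
      case 2
      then have "filter (\<lambda>z. z = x \<or> z = y) vs = filter (\<lambda>z. z = x) vs"
        using Cons.prems by (intro filter_cong) auto
      then show ?thesis using 2 Cons.prems by (auto simp: single)
    next
      case 3
      then show ?thesis using Cons by auto
    qed
  qed simp
qed

text \<open>The linear core after the cut: \<open>[a x, b x)\<close> is the arc of \<open>x\<close>,
  and \<open>[s y, t y)\<close> is the gap of \<open>y\<close>. By \<open>mid\<close> one cut point
  \<open>m\<close> suits all gaps; by \<open>cross\<close> no arc contains a gap together with the
  points just before and just after it.\<close>

lemma split_graph_word_representable:
  fixes V :: "'a set" and c :: "nat \<Rightarrow> 'a" and a b s t :: "'a \<Rightarrow> nat"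
  assumes V: "finite V"
    and split: "split_partition V E K (X \<union> Y)" and XY: "X \<inter> Y = {}"
    and c: "bij_betw c {..<l} K"
    and nbX: "\<And>x j. x \<in> X \<Longrightarrow> j < l \<Longrightarrow> {x, c j} \<in> E \<longleftrightarrow> a x \<le> j \<and> j < b x"
    and nbY: "\<And>y j. y \<in> Y \<Longrightarrow> j < l \<Longrightarrow> {y, c j} \<in> E \<longleftrightarrow> j < s y \<or> t y \<le> j"
    and mid: "\<And>y. y \<in> Y \<Longrightarrow> s y \<le> m \<and> m \<le> t y"
    and cross: "\<And>x y. x \<in> X \<Longrightarrow> y \<in> Y \<Longrightarrow> b x \<le> t y \<or> s y \<le> a x"
  shows "word_representable V E"
proof -
  have V_eq: "V = K \<union> X \<union> Y" and disj: "K \<inter> X = {}" "K \<inter> Y = {}"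
    and clq: "\<And>x y. x \<in> K \<Longrightarrow> y \<in> K \<Longrightarrow> x \<noteq> y \<Longrightarrow> {x, y} \<in> E"
    and ind: "\<And>x y. x \<in> X \<union> Y \<Longrightarrow> y \<in> X \<union> Y \<Longrightarrow> {x, y} \<notin> E"
    using split by (auto simp: split_partition_def clique_def independent_def)
  obtain vs where vs: "set vs = V" "distinct vs"
    using V finite_distinct_list by blast
  define pos where "pos = the_inv_into {..<l} c"
  have pos: "pos (c j) = j" if "j < l" for j
    using that c unfolding pos_def by (auto simp: bij_betw_def the_inv_into_f_f)
  have K_eq: "K = c ` {..<l}" using c by (simp add: bij_betw_def)
  \<comment> \<open>The letter \<open>c j\<close> gets the key \<open>3 * j + 2\<close>; the keys \<open>3 * p\<close> and \<open>3 * p + 1\<close> both lie between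
    those of \<open>c (p - 1)\<close> and \<open>c p\<close>, and are used to order members of \<open>X\<close> and \<open>Y\<close> placed there.\<close>
  define f where "f v = (if v \<in> K then 3 * pos v + 2 else if v \<in> X then 3 * b v else 3 * t v + 1)" for v
  define g where "g v = (if v \<in> K then 3 * pos v + 2 else 3 * m)" for v
  define h where "h v = (if v \<in> K then 3 * pos v + 2 else if v \<in> X then 3 * a v + 1 else 3 * s v)" for v
  define word where "word u =
      filter (\<lambda>v. v \<in> X) u @ sort_key f u @ sort_key g (filter (\<lambda>v. v \<notin> X) u) @
      filter (\<lambda>v. v \<in> X) u @ sort_key g (rev (filter (\<lambda>v. v \<notin> X) u)) @ sort_key h u @
      rev (filter (\<lambda>v. v \<in> X) u)" for u
  \<comment> \<open>As \<open>sort_key\<close> is stable it commutes with \<open>filter\<close>, so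
    alternation of \<open>x\<close> and \<open>y\<close> in \<open>word vs\<close> can be read off
    from \<open>word [x, y]\<close> or \<open>word [y, x]\<close>.\<close>
  have filter_word: "filter P (word u) = word (filter P u)" for P u
    by (simp add: word_def filter_sort rev_filter conj_commute)
  have alt: "alternate x y (word vs) \<longleftrightarrow> distinct_adj (word [x, y])
      \<and> filter (\<lambda>z. z = x \<or> z = y) vs = [x, y] \<or> distinct_adj (word [y, x]) \<and>
      filter (\<lambda>z. z = x \<or> z = y) vs = [y, x]"
    if "x \<in> V" "y \<in> V" "x \<noteq> y" for x y
    using filter_pair_distinct[of vs x y] vs that
    by (auto simp: alternate_iff_distinct_adj filter_word)
  have eq: "alternate x y (word vs) \<longleftrightarrow> {x, y} \<in> E"
    if "x \<in> V" "y \<in> V" "x \<noteq> y"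
      "distinct_adj (word [x, y]) \<longleftrightarrow> {x, y} \<in> E" "distinct_adj (word [y, x]) \<longleftrightarrow> {x, y} \<in> E" for x y
    using alt[OF that(1-3)] filter_pair_distinct[of vs x y] vs that by auto
  have key_le: "3 * p \<le> Suc (Suc (3 * q)) \<longleftrightarrow> p \<le> q" "Suc (Suc (3 * p)) \<le> 3 * q \<longleftrightarrow> p < q"
    "3 * p \<le> Suc (3 * q) \<longleftrightarrow> p \<le> q" "Suc (3 * p) \<le> 3 * q \<longleftrightarrow> p < q" for p q :: nat
    by presburger+
  note sort2 = word_def f_def g_def h_def key_le
  have KK: "alternate x y (word vs) \<longleftrightarrow> {x, y} \<in> E" if asm: "x \<in> K" "y \<in> K" "x \<noteq> y" for x y
  proof (rule eq)
    obtain i j where "x = c i" "y = c j" "i < l" "j < l" using asm K_eq by blast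
    moreover from this have "i \<noteq> j" using that by auto
    moreover have "x \<notin> X" "y \<notin> X" using disj that by auto
    ultimately show "distinct_adj (word [x, y]) \<longleftrightarrow> {x, y} \<in> E" "distinct_adj (word [y, x]) \<longleftrightarrow> {x, y} \<in> E"
      using that clq pos by (auto simp: sort2)
  qed (use that V_eq in auto)
  \<comment> \<open>Outside the \<open>f\<close> and \<open>h\<close> copies the letters form
    \<open>x\<close>, then \<open>yxy\<close>, then \<open>x\<close>. Alternation thus forces
    \<open>yx\<close> in the \<open>f\<close> copy and \<open>xy\<close> in the \<open>h\<close>
    copy, which for \<open>y = c j\<close> means \<open>j < b x\<close> and
    \<open>a x \<le> j\<close>.\<close>
  have XK: "alternate x y (word vs) \<longleftrightarrow> {x, y} \<in> E" if asm: "x \<in> X" "y \<in> K" for x y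
  proof (rule eq)
    obtain j where "y = c j" "j < l" using asm K_eq by blast
    moreover have "x \<notin> K" "y \<notin> X" "x \<noteq> y" using disj that by auto
    ultimately show "distinct_adj (word [x, y]) \<longleftrightarrow> {x, y} \<in> E" "distinct_adj (word [y, x]) \<longleftrightarrow> {x, y} \<in> E"
      using that nbX pos by (auto simp: sort2)
  qed (use that V_eq disj in auto)
  \<comment> \<open>Alternation means equal order in all four copies; the outer two agree iff
    \<open>j\<close> is outside the gap, and then \<open>mid\<close> makes the middle two
    conform.\<close>
  have YK: "alternate x y (word vs) \<longleftrightarrow> {x, y} \<in> E" if asm: "x \<in> Y" "y \<in> K" for x y
  proof (rule eq)
    obtain j where "y = c j" "j < l" using asm K_eq by blast
    moreover have "x \<notin> K" "x \<notin> X" "y \<notin> X" "x \<noteq> y" using disj XY that by auto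
    ultimately show "distinct_adj (word [x, y]) \<longleftrightarrow> {x, y} \<in> E" "distinct_adj (word [y, x]) \<longleftrightarrow> {x, y} \<in> E"
      using that nbY pos mid[of x] by (auto simp: sort2)
  qed (use that V_eq disj in auto)
  \<comment> \<open>As for a clique letter \<open>y\<close>, alternation would need
    \<open>t y < b x\<close> and \<open>a x < s y\<close>; ties in the keys break against
    it.\<close>
  have XY': "alternate x y (word vs) \<longleftrightarrow> {x, y} \<in> E" if "x \<in> X" "y \<in> Y" for x y
  proof (rule eq)
    have "x \<notin> K" "y \<notin> K" "y \<notin> X" "x \<noteq> y" using disj XY that by auto
    then show "distinct_adj (word [x, y]) \<longleftrightarrow> {x, y} \<in> E" "distinct_adj (word [y, x]) \<longleftrightarrow> {x, y} \<in> E"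
      using that ind cross[of x y] by (auto simp: sort2)
  qed (use that V_eq XY in auto)
  \<comment> \<open>A reversal next to an unreversed block repeats a letter: for \<open>X\<close> at
    the end of the word at the latest, for \<open>Y\<close> (equal \<open>g\<close> keys) in the
    middle.\<close>
  have AA: "alternate x y (word vs) \<longleftrightarrow> {x, y} \<in> E"
    if "x \<in> X \<and> y \<in> X \<or> x \<in> Y \<and> y \<in> Y" "x \<noteq> y" for x y
  proof (rule eq)
    have "x \<notin> K" "y \<notin> K" "x \<in> X \<and> y \<in> X \<or> x \<notin> X \<and> y \<notin> X" "{x, y} \<notin> E"
      using disj XY that ind by auto
    then show "distinct_adj (word [x, y]) \<longleftrightarrow> {x, y} \<in> E" "distinct_adj (word [y, x]) \<longleftrightarrow> {x, y} \<in> E"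
      using that by (auto simp: sort2)
  qed (use that V_eq in auto)
  have "set (word vs) = V" using vs by (auto simp: word_def)
  moreover have "alternate x y (word vs) \<longleftrightarrow> {x, y} \<in> E" if "x \<in> V" "y \<in> V" "x \<noteq> y" for x y
  proof -
    have "x \<in> K \<or> x \<in> X \<or> x \<in> Y" "y \<in> K \<or> y \<in> X \<or> y \<in> Y" using that V_eq by auto
    then show ?thesis
      using KK[of x y] XK[of x y] XK[of y x] YK[of x y] YK[of y x] XY'[of x y] XY'[of y x] AA[of x y]
        that alternate_commute[of x y] insert_commute[of x y "{}"] by (elim disjE) simp_all
  qed
  ultimately show ?thesis unfolding word_representable_def by blast
qed

lemma mod_add_less:
  fixes i j l :: nat
  assumes "i < l" "j < l"
  shows "(i + j) mod l = (if i + j < l then i + j else i + j - l)"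
  using assms by (simp add: le_mod_geq)

text \<open>A position is reached directly or after one turn; an arc ending exactly at the cut
  counts as not wrapping.\<close>

lemma mod_add_image_lessThan:
  fixes i k l :: nat
  assumes "i < l" "k \<le> l"
  shows "(\<lambda>j. (i + j) mod l) ` {..<k} =
    (if i + k \<le> l then {i..<i + k} else {..<i + k - l} \<union> {i..<l})"
proof (rule set_eqI)
  fix x
  have "x \<in> (\<lambda>j. (i + j) mod l) ` {..<k} \<longleftrightarrow> x < l \<and> (i \<le> x \<and> x < i + k \<or> x + l < i + k)"
  proof
    assume "x \<in> (\<lambda>j. (i + j) mod l) ` {..<k}"
    then obtain j where j: "j < k" "x = (i + j) mod l" by auto
    then have "x = (if i + j < l then i + j else i + j - l)"
      using assms mod_add_less[of i l j] by simp
    then show "x < l \<and> (i \<le> x \<and> x < i + k \<or> x + l < i + k)"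
      using assms j(1) by (simp split: if_splits)
  next
    assume x: "x < l \<and> (i \<le> x \<and> x < i + k \<or> x + l < i + k)"
    define j where "j = (if i \<le> x \<and> x < i + k then x - i else x + l - i)"
    have "j < k" using x assms unfolding j_def by (simp; linarith)
    moreover from this have "x = (i + j) mod l"
      using x assms mod_add_less[of i l j] unfolding j_def by (simp split: if_splits)
    ultimately show "x \<in> (\<lambda>j. (i + j) mod l) ` {..<k}" by blast
  qed
  then show "x \<in> (\<lambda>j. (i + j) mod l) ` {..<k} \<longleftrightarrow>
      x \<in> (if i + k \<le> l then {i..<i + k} else {..<i + k - l} \<union> {i..<l})"
    using assms by (simp only:) (simp; linarith)
qed

theorem corollary20:
  fixes k l :: nat and V :: "'a set" and E :: "'a set set"
  assumes "k \<ge> 1" and "l \<ge> 2 * k - 1"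
    and "is_K_graph l k V E"
  shows "word_representable V E"
proof -
  obtain K A c where fin: "finite V" and split: "split_partition V E K A"
    and c: "bij_betw c {..<l} K"
    and card: "\<And>v. v \<in> A \<Longrightarrow> card (neighbourhood E v) = k"
    and arc: "\<And>v. v \<in> A \<Longrightarrow> consecutive_on_circle l c (neighbourhood E v)"
    using assms(3) by (auto simp: is_K_graph_def simple_graph_def)
  have inj: "inj_on c {..<l}" using c by (simp add: bij_betw_def)
  \<comment> \<open>The arc length, left open by \<open>consecutive_on_circle\<close>, equals the
    cardinality \<open>k\<close> by injectivity.\<close>
  have "\<exists>i<l. k \<le> l \<and> neighbourhood E v = c ` (\<lambda>j. (i + j) mod l) ` {..<k}" if v: "v \<in> A" for v
  proof -
    obtain i n where i: "i < l" "n \<le> l"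
      and N: "neighbourhood E v = c ` (\<lambda>j. (i + j) mod l) ` {..<n}"
      using arc[OF v] by (auto simp: consecutive_on_circle_def image_image)
    have "inj_on (\<lambda>j. (i + j) mod l) {..<n}"
      using i by (auto simp: inj_on_def mod_add_less split: if_splits)
    moreover have "inj_on c ((\<lambda>j. (i + j) mod l) ` {..<n})"
      using i by (intro inj_on_subset[OF inj]) auto
    ultimately have "card (neighbourhood E v) = n" by (simp add: N card_image)
    then show ?thesis using card[OF v] i N by auto
  qed
  then obtain p where p: "\<And>v. v \<in> A \<Longrightarrow> p v < l" "\<And>v. v \<in> A \<Longrightarrow> k \<le> l"
    and N: "\<And>v. v \<in> A \<Longrightarrow> neighbourhood E v = c ` (\<lambda>j. (p v + j) mod l) ` {..<k}"
    by metis
  have edge: "{v, c j} \<in> E \<longleftrightarrow>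
      j \<in> (if p v + k \<le> l then {p v..<p v + k} else {..<p v + k - l} \<union> {p v..<l})"
    if "v \<in> A" "j < l" for v j
  proof -
    have "{v, c j} \<in> E \<longleftrightarrow> c j \<in> neighbourhood E v" by (simp add: neighbourhood_def)
    also have "\<dots> \<longleftrightarrow> j \<in> (\<lambda>j. (p v + j) mod l) ` {..<k}"
      unfolding N[OF that(1)] using that by (intro inj_on_image_mem_iff[OF inj]) auto
    finally show ?thesis using mod_add_image_lessThan[OF p[OF that(1)]] by simp
  qed
  define X where "X = {v \<in> A. p v + k \<le> l}"
  have A: "A = X \<union> (A - X)" by (auto simp: X_def)
  show ?thesis
  \<comment> \<open>For a wrapping arc, \<open>p v < l\<close> bounds the initial part by
    \<open>k - 1\<close> points, and \<open>p v > l - k \<ge> k - 1\<close>.\<close>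
  proof (rule split_graph_word_representable[where X = X and Y = "A - X" and m = "k - 1"
        and a = p and b = "\<lambda>v. p v + k" and s = "\<lambda>v. p v + k - l" and t = p])
    show "split_partition V E K (X \<union> (A - X))" using split A by simp
    show "p v + k - l \<le> k - 1 \<and> k - 1 \<le> p v" if "v \<in> A - X" for v
      using that p(1)[of v] assms(1,2) by (auto simp: X_def)
    \<comment> \<open>If both failed, adding the inequalities would give
      \<open>l \<le> 2 * k - 2\<close>.\<close>
    show "p x + k \<le> p y \<or> p y + k - l \<le> p x" if "x \<in> X" "y \<in> A - X" for x y
      using that assms(1,2) by (auto simp: X_def)
    show "{v, c j} \<in> E \<longleftrightarrow> p v \<le> j \<and> j < p v + k" if "v \<in> X" "j < l" for v j
      using that edge[of v j] by (simp add: X_def)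
    show "{v, c j} \<in> E \<longleftrightarrow> j < p v + k - l \<or> p v \<le> j" if "v \<in> A - X" "j < l" for v j
      using that edge[of v j] by (simp add: X_def)
    show "finite V" by (rule fin)
    show "bij_betw c {..<l} K" by (rule c)
    show "X \<inter> (A - X) = {}" by blast
  qed
qed

end
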